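(* The following conditions are equivalent for a $T_0$ space $X$: (1) $X$ is sober. (2) For any irreducible closed subset $A$ of $X$ and any $K\in\mathbf{up}(X)$: $\Psi_{\mathbf{up}(X)}(A)$ is a filter of $\mathbf{up}(X)$, $\max(A)\neq\emptyset$, and $\mathord{\downarrow}(A\cap K)$ is closed in $X$. (3) For any irreducible closed subset $A$ of $X$ and any $K\in\mathsf{K}(X)$: $\Psi_{\mathsf{K}(X)}(A)$ is a filter of $\mathsf{K}(X)$, $\max(A)\neq\emptyset$, and $\mathord{\downarrow}(A\cap K)$ is closed in $X$.
   Context: A $T_0$ space $X$ is regarded as a poset under its specialization order: $x\leq y$ iff $x\in\overline{\{y\}}$; $\mathord{\downarrow}$ denotes lower closure in this order and $\max(A)$ is the set of maximal elements of $A$. $\mathbf{up}(X)$ is the set of all nonempty upper subsets of $X$, and $\mathsf{K}(X)$ is the set of all nonempty compact saturated subsets of $X$ (saturated = intersection of open sets = upper set). Both are ordered by set inclusion $\subseteq$; a filter of such a poset is a nonempty subset that is upward closed and in which any two elements have a lower bound belonging to the subset. For $A\subseteq X$, $\Psi_{\mathbf{up}(X)}(A)=\{K\in\mathbf{up}(X):K\cap A\neq\emptyset\}$ and $\Psi_{\mathsf{K}(X)}(A)=\{K\in\mathsf{K}(X):K\cap A\neq\emptyset\}$. A nonempty set $A$ is irreducible if $A\subseteq F_1\cup F_2$ with $F_1,F_2$ closed implies $A\subseteq F_1$ or $A\subseteq F_2$. $X$ is sober if every irreducible closed set is $\overline{\{a\}}$ for a unique point $a\in X$. *)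

theory Defs
  imports "HOL-Analysis.Analysis"
begin

text \<open>Spaces are values of type \<^typ>\<open>'a topology\<close>.\<close>

text \<open>The specialization order. No carrier condition is needed: since
  \<^term>\<open>X closure_of S\<close> is contained in \<^term>\<open>topspace X\<close> and only depends on
  \<^term>\<open>topspace X \<inter> S\<close>, \<open>spec_le X x y\<close> forces both points to lie in the space
  (see \<open>spec_le_imp_topspace\<close> below).\<close>

definition spec_le :: "'a topology \<Rightarrow> 'a \<Rightarrow> 'a \<Rightarrow> bool" where
  "spec_le X x y \<longleftrightarrow> x \<in> X closure_of {y}"

definition down_closure :: "'a topology \<Rightarrow> 'a set \<Rightarrow> 'a set" where
  "down_closure X A = {x \<in> topspace X. \<exists>a\<in>A. spec_le X x a}"

definition max_elements :: "'a topology \<Rightarrow> 'a set \<Rightarrow> 'a set" where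
  "max_elements X A = {m \<in> A. \<forall>x\<in>A. spec_le X m x \<longrightarrow> x = m}"

definition upper_set_in :: "'a topology \<Rightarrow> 'a set \<Rightarrow> bool" where
  "upper_set_in X S \<longleftrightarrow>
     S \<subseteq> topspace X \<and> (\<forall>x\<in>S. \<forall>y\<in>topspace X. spec_le X x y \<longrightarrow> y \<in> S)"

text \<open>The family is required to be nonempty because \<open>\<Inter>{} = UNIV\<close> is not relative to the
  space; this loses nothing, as \<^term>\<open>topspace X\<close> is itself open.\<close>

definition saturated_in :: "'a topology \<Rightarrow> 'a set \<Rightarrow> bool" where
  "saturated_in X S \<longleftrightarrow> (\<exists>\<U>. \<U> \<noteq> {} \<and> (\<forall>U\<in>\<U>. openin X U) \<and> S = \<Inter>\<U>)"

definition up_sets :: "'a topology \<Rightarrow> 'a set set" where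
  "up_sets X = {K. K \<noteq> {} \<and> upper_set_in X K}"

definition compact_saturated_sets :: "'a topology \<Rightarrow> 'a set set" where
  "compact_saturated_sets X = {K. K \<noteq> {} \<and> compactin X K \<and> saturated_in X K}"

text \<open>\<open>hitting \<S> A\<close> is \<open>\<Psi>\<^bsub>\<S>\<^esub>(A)\<close>.\<close>

definition hitting :: "'a set set \<Rightarrow> 'a set \<Rightarrow> 'a set set" where
  "hitting \<S> A = {K \<in> \<S>. K \<inter> A \<noteq> {}}"

text \<open>Filters of a subset \<open>P\<close> of an ordered type, with the induced order. For sets of sets
  the order is inclusion.\<close>

definition poset_filter :: "'b::order set \<Rightarrow> 'b set \<Rightarrow> bool" where
  "poset_filter P F \<longleftrightarrow>
     F \<subseteq> P \<and> F \<noteq> {} \<and>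
     (\<forall>x\<in>F. \<forall>y\<in>P. x \<le> y \<longrightarrow> y \<in> F) \<and>
     (\<forall>x\<in>F. \<forall>y\<in>F. \<exists>z\<in>F. z \<le> x \<and> z \<le> y)"

definition irreducible_in :: "'a topology \<Rightarrow> 'a set \<Rightarrow> bool" where
  "irreducible_in X A \<longleftrightarrow>
     A \<subseteq> topspace X \<and> A \<noteq> {} \<and>
     (\<forall>F\<^sub>1 F\<^sub>2. closedin X F\<^sub>1 \<and> closedin X F\<^sub>2 \<and> A \<subseteq> F\<^sub>1 \<union> F\<^sub>2 \<longrightarrow> A \<subseteq> F\<^sub>1 \<or> A \<subseteq> F\<^sub>2)"

definition sober_space :: "'a topology \<Rightarrow> bool" where
  "sober_space X \<longleftrightarrow>
     (\<forall>A. closedin X A \<and> irreducible_in X A \<longrightarrow> (\<exists>!a. a \<in> topspace X \<and> A = X closure_of {a}))"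

lemma spec_le_imp_topspace:
  assumes "spec_le X x y"
  shows "x \<in> topspace X" and "y \<in> topspace X"
  using assms openin_topspace unfolding spec_le_def in_closure_of by blast+

lemma saturated_in_iff_upper_set_in: "saturated_in X S \<longleftrightarrow> upper_set_in X S"
proof
  assume "saturated_in X S"
  then obtain \<U> where \<U>: "\<U> \<noteq> {}" "\<And>U. U \<in> \<U> \<Longrightarrow> openin X U" "S = \<Inter>\<U>"
    unfolding saturated_in_def by blast
  then have "S \<subseteq> topspace X"
    using openin_subset by blast
  then show "upper_set_in X S"
    using \<U> by (auto simp: upper_set_in_def spec_le_def in_closure_of)
next
  assume S: "upper_set_in X S"
  let ?\<U> = "{U. openin X U \<and> S \<subseteq> U}"
  have "x \<in> S" if x: "x \<in> \<Inter>?\<U>" for x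
  proof (rule ccontr)
    assume "x \<notin> S"
    have xX: "x \<in> topspace X"
      using x S by (auto simp: upper_set_in_def)
    have "openin X (topspace X - X closure_of {x})"
      by (simp add: openin_diff)
    moreover have "S \<subseteq> topspace X - X closure_of {x}"
      using S \<open>x \<notin> S\<close> xX by (auto simp: upper_set_in_def spec_le_def)
    ultimately have "x \<notin> X closure_of {x}"
      using x by blast
    then show False
      using xX by (simp add: in_closure_of)
  qed
  then have "S = \<Inter>?\<U>"
    by blast
  moreover have "topspace X \<in> ?\<U>"
    using S by (simp add: upper_set_in_def)
  ultimately show "saturated_in X S"
    unfolding saturated_in_def by (intro exI[of _ ?\<U>]) blast
qed

end

theory Submission
  imports Defs
begin

text \<open>
  Write \<open>\<up>x\<close> for the set of points above \<open>x\<close> in the specialization order. Both \<^term>\<open>up_sets X\<close>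
  and \<^term>\<open>compact_saturated_sets X\<close> consist of upper sets and contain every \<open>\<up>x\<close>, and these two
  properties of a family \<open>\<S>\<close> suffice for the equivalence (\<open>sober_iff_hitting_filter\<close>), so both
  equivalences are instances of one argument.

  If \<open>A\<close> is the closure of \<open>a\<close>, that is, the set of points below \<open>a\<close>, then an upper set meets \<open>A\<close>
  iff it contains \<open>a\<close>. Hence \<open>\<Psi>(A)\<close> is the principal filter of \<open>\<up>a\<close>, the point \<open>a\<close> is the greatest
  element of \<open>A\<close>, and \<open>\<down>(A \<inter> K)\<close> is either \<open>A\<close> or empty.

  Conversely, if \<open>\<Psi>(A)\<close> is a filter, then \<open>A\<close> is directed: for \<open>x, y \<in> A\<close>, a member of \<open>\<Psi>(A)\<close>
  below \<open>\<up>x\<close> and \<open>\<up>y\<close> meets \<open>A\<close> in a common upper bound of \<open>x\<close> and \<open>y\<close>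
  (\<open>hitting_filter_imp_directed\<close>). A maximal element of a directed set is its greatest element, so
  the closed set \<open>A\<close> is the closure of a point, which is unique by \<open>T\<^sub>0\<close>.
\<close>

section \<open>The specialization order\<close>

definition principal_up :: "'a topology \<Rightarrow> 'a \<Rightarrow> 'a set" where
  "principal_up X x = {y \<in> topspace X. spec_le X x y}"

lemma spec_le_refl: "x \<in> topspace X \<Longrightarrow> spec_le X x x"
  by (simp add: spec_le_def in_closure_of)

lemma spec_le_trans: "spec_le X x y \<Longrightarrow> spec_le X y z \<Longrightarrow> spec_le X x z"
  by (auto simp: spec_le_def in_closure_of)

lemma t0_space_spec_le_antisym:
  assumes "t0_space X" "spec_le X x y" "spec_le X y x"
  shows "x = y"
proof (rule ccontr)
  assume "x \<noteq> y"
  moreover have "x \<in> topspace X" "y \<in> topspace X"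
    using spec_le_imp_topspace[OF assms(2)] by blast+
  ultimately obtain U where "openin X U" "x \<notin> U \<longleftrightarrow> y \<in> U"
    using assms(1) unfolding t0_space_def by meson
  then show False
    using assms(2,3) by (auto simp: spec_le_def in_closure_of)
qed

lemma spec_le_closedin:
  assumes "closedin X A" "y \<in> A" "spec_le X x y"
  shows "x \<in> A"
  using assms closure_of_minimal[of "{y}" A X] by (auto simp: spec_le_def)

lemma principal_up_upper: "upper_set_in X (principal_up X x)"
  by (auto simp: upper_set_in_def principal_up_def intro: spec_le_trans)

lemma principal_up_self: "x \<in> topspace X \<Longrightarrow> x \<in> principal_up X x"
  by (simp add: principal_up_def spec_le_refl)

text \<open>Any open set containing \<open>x\<close> contains everything above \<open>x\<close>, so the member of an open cover
  that contains \<open>x\<close> is already a subcover.\<close>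

lemma principal_up_compactin:
  assumes "x \<in> topspace X"
  shows "compactin X (principal_up X x)"
  unfolding compactin_def
proof (intro conjI allI impI)
  show "principal_up X x \<subseteq> topspace X"
    by (auto simp: principal_up_def)
  fix \<U> assume \<U>: "Ball \<U> (openin X) \<and> principal_up X x \<subseteq> \<Union>\<U>"
  then obtain U where U: "U \<in> \<U>" "x \<in> U"
    using principal_up_self[OF assms] by blast
  moreover from this have "openin X U"
    using \<U> by blast
  ultimately have "principal_up X x \<subseteq> U"
    unfolding principal_up_def spec_le_def in_closure_of by blast
  then show "\<exists>\<F>. finite \<F> \<and> \<F> \<subseteq> \<U> \<and> principal_up X x \<subseteq> \<Union>\<F>"
    using U by (intro exI[of _ "{U}"]) simp
qed

section \<open>Closures of points\<close>

lemma upper_set_meets_point_closure_iff: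
  assumes "a \<in> topspace X" "upper_set_in X K"
  shows "K \<inter> X closure_of {a} \<noteq> {} \<longleftrightarrow> a \<in> K"
proof
  assume "K \<inter> X closure_of {a} \<noteq> {}"
  then show "a \<in> K"
    using assms by (auto simp: upper_set_in_def spec_le_def)
next
  assume "a \<in> K"
  then show "K \<inter> X closure_of {a} \<noteq> {}"
    using spec_le_refl[OF assms(1)] by (auto simp: spec_le_def)
qed

lemma hitting_point_closure_filter:
  assumes a: "a \<in> topspace X"
    and upper: "\<And>K. K \<in> \<S> \<Longrightarrow> upper_set_in X K"
    and principal: "principal_up X a \<in> \<S>"
  shows "poset_filter \<S> (hitting \<S> (X closure_of {a}))"
proof -
  have eq: "hitting \<S> (X closure_of {a}) = {K \<in> \<S>. a \<in> K}"
    using upper_set_meets_point_closure_iff[OF a upper] by (auto simp: hitting_def)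
  have least: "principal_up X a \<subseteq> K" if "K \<in> \<S>" "a \<in> K" for K
    using upper[OF that(1)] that(2) by (auto simp: upper_set_in_def principal_up_def)
  have self: "principal_up X a \<in> {K \<in> \<S>. a \<in> K}"
    using principal principal_up_self[OF a] by simp
  show ?thesis
    unfolding eq poset_filter_def
  proof (intro conjI ballI impI)
    show "{K \<in> \<S>. a \<in> K} \<noteq> {}"
      using self by blast
  next
    fix K L assume "K \<in> {K \<in> \<S>. a \<in> K}" "L \<in> {K \<in> \<S>. a \<in> K}"
    then show "\<exists>M\<in>{K \<in> \<S>. a \<in> K}. M \<subseteq> K \<and> M \<subseteq> L"
      using self least by (intro bexI[of _ "principal_up X a"]) auto
  qed auto
qed

lemma max_elements_point_closure:
  assumes "t0_space X" "a \<in> topspace X"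
  shows "a \<in> max_elements X (X closure_of {a})"
  using spec_le_refl[OF assms(2)] t0_space_spec_le_antisym[OF assms(1)]
  by (auto simp: max_elements_def spec_le_def)

lemma down_closure_point_closure_closedin:
  assumes a: "a \<in> topspace X" and K: "upper_set_in X K"
  shows "closedin X (down_closure X (X closure_of {a} \<inter> K))"
proof (cases "a \<in> K")
  case True
  have "down_closure X (X closure_of {a} \<inter> K) = X closure_of {a}"
  proof
    show "down_closure X (X closure_of {a} \<inter> K) \<subseteq> X closure_of {a}"
      by (auto simp: down_closure_def intro: spec_le_closedin[OF closedin_closure_of])
    have "a \<in> X closure_of {a} \<inter> K"
      using True spec_le_refl[OF a] by (simp add: spec_le_def)
    then show "X closure_of {a} \<subseteq> down_closure X (X closure_of {a} \<inter> K)"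
      using closure_of_subset_topspace[of X "{a}"]
      unfolding down_closure_def spec_le_def by blast
  qed
  then show ?thesis
    by simp
next
  case False
  then have "X closure_of {a} \<inter> K = {}"
    using upper_set_meets_point_closure_iff[OF a K] by blast
  then show ?thesis
    by (simp add: down_closure_def)
qed

section \<open>Filters of sets meeting a closed set\<close>

lemma hitting_filter_imp_directed:
  assumes filter: "poset_filter \<S> (hitting \<S> A)"
    and principal: "\<And>x. x \<in> topspace X \<Longrightarrow> principal_up X x \<in> \<S>"
    and A: "A \<subseteq> topspace X" and "x \<in> A" "y \<in> A"
  obtains z where "z \<in> A" "spec_le X x z" "spec_le X y z"
proof -
  have "principal_up X w \<in> hitting \<S> A" if "w \<in> A" for w
    using that A principal principal_up_self[of w X] by (auto simp: hitting_def)
  then obtain K where "K \<in> hitting \<S> A" "K \<subseteq> principal_up X x" "K \<subseteq> principal_up X y"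
    using filter \<open>x \<in> A\<close> \<open>y \<in> A\<close> unfolding poset_filter_def by meson
  then show ?thesis
    using that by (auto simp: hitting_def principal_up_def)
qed

lemma closed_directed_with_max_eq_point_closure:
  assumes A: "closedin X A"
    and directed: "\<And>x y. x \<in> A \<Longrightarrow> y \<in> A \<Longrightarrow> \<exists>z\<in>A. spec_le X x z \<and> spec_le X y z"
    and m: "m \<in> max_elements X A"
  shows "A = X closure_of {m}"
proof
  have mA: "m \<in> A"
    using m by (simp add: max_elements_def)
  show "X closure_of {m} \<subseteq> A"
    using closure_of_minimal[OF _ A] mA by simp
  show "A \<subseteq> X closure_of {m}"
  proof
    fix x assume "x \<in> A"
    then obtain z where "z \<in> A" "spec_le X x z" "spec_le X m z"
      using directed mA by blast
    moreover from this have "z = m"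
      using m by (simp add: max_elements_def)
    ultimately show "x \<in> X closure_of {m}"
      by (simp add: spec_le_def)
  qed
qed

section \<open>The characterization of sobriety\<close>

lemma sober_iff_hitting_filter:
  assumes t0: "t0_space X"
    and upper: "\<And>K. K \<in> \<S> \<Longrightarrow> upper_set_in X K"
    and principal: "\<And>x. x \<in> topspace X \<Longrightarrow> principal_up X x \<in> \<S>"
  shows "sober_space X \<longleftrightarrow>
    (\<forall>A K. closedin X A \<and> irreducible_in X A \<and> K \<in> \<S> \<longrightarrow>
      poset_filter \<S> (hitting \<S> A) \<and> max_elements X A \<noteq> {} \<and>
      closedin X (down_closure X (A \<inter> K)))" (is "_ \<longleftrightarrow> ?R")
proof
  assume sober: "sober_space X"
  show ?R
  proof (intro allI impI)
    fix A K assume AK: "closedin X A \<and> irreducible_in X A \<and> K \<in> \<S>"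
    then obtain a where a: "a \<in> topspace X" and A: "A = X closure_of {a}"
      using sober unfolding sober_space_def by metis
    from AK have K: "upper_set_in X K"
      using upper by blast
    show "poset_filter \<S> (hitting \<S> A) \<and> max_elements X A \<noteq> {} \<and>
      closedin X (down_closure X (A \<inter> K))"
      unfolding A
    proof (intro conjI)
      show "poset_filter \<S> (hitting \<S> (X closure_of {a}))"
        using a upper principal[OF a] by (rule hitting_point_closure_filter)
      show "max_elements X (X closure_of {a}) \<noteq> {}"
        using max_elements_point_closure[OF t0 a] by blast
      show "closedin X (down_closure X (X closure_of {a} \<inter> K))"
        using a K by (rule down_closure_point_closure_closedin)
    qed
  qed
next
  assume R: ?R
  show "sober_space X"
    unfolding sober_space_def
  proof (intro allI impI)
    fix A assume A: "closedin X A \<and> irreducible_in X A"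
    then have sub: "A \<subseteq> topspace X" and "A \<noteq> {}"
      by (auto simp: irreducible_in_def)
    \<comment> \<open>The condition speaks of \<open>A\<close> only in the presence of some \<open>K \<in> \<S>\<close>;
      a point of \<open>A\<close> provides one.\<close>
    from \<open>A \<noteq> {}\<close> obtain w where "w \<in> A"
      by blast
    then have "principal_up X w \<in> \<S>"
      using sub principal by blast
    from R[rule_format, OF conjI, OF conjunct1[OF A] conjI, OF conjunct2[OF A] this]
    have filter: "poset_filter \<S> (hitting \<S> A)" and "max_elements X A \<noteq> {}"
      by simp_all
    then obtain m where m: "m \<in> max_elements X A"
      by blast
    have "\<exists>z\<in>A. spec_le X x z \<and> spec_le X y z" if "x \<in> A" "y \<in> A" for x y
      by (rule hitting_filter_imp_directed[OF filter principal sub that]) auto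
    then have eq: "A = X closure_of {m}"
      by (rule closed_directed_with_max_eq_point_closure[OF conjunct1[OF A] _ m])
    have mX: "m \<in> topspace X"
      using m sub by (auto simp: max_elements_def)
    show "\<exists>!a. a \<in> topspace X \<and> A = X closure_of {a}"
    proof (intro ex1I[of _ m] conjI mX eq)
      fix b assume b: "b \<in> topspace X \<and> A = X closure_of {b}"
      then have "X closure_of {b} = X closure_of {m}"
        using eq by simp
      then have "spec_le X b m" "spec_le X m b"
        using b spec_le_refl[of b X] spec_le_refl[OF mX] by (simp_all add: spec_le_def)
      then show "b = m"
        by (rule t0_space_spec_le_antisym[OF t0])
    qed
  qed
qed

theorem theorem3p38:
  fixes X :: "'a topology"
  assumes "t0_space X"
  shows "(sober_space X \<longleftrightarrow>
            (\<forall>A K. closedin X A \<and> irreducible_in X A \<and> K \<in> up_sets X \<longrightarrow>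
               poset_filter (up_sets X) (hitting (up_sets X) A) \<and>
               max_elements X A \<noteq> {} \<and>
               closedin X (down_closure X (A \<inter> K)))) \<and>
         (sober_space X \<longleftrightarrow>
            (\<forall>A K. closedin X A \<and> irreducible_in X A \<and> K \<in> compact_saturated_sets X \<longrightarrow>
               poset_filter (compact_saturated_sets X) (hitting (compact_saturated_sets X) A) \<and>
               max_elements X A \<noteq> {} \<and>
               closedin X (down_closure X (A \<inter> K))))"
proof (rule conjI; rule sober_iff_hitting_filter[OF assms])
  fix x assume x: "x \<in> topspace X"
  show "principal_up X x \<in> up_sets X"
    using principal_up_self[OF x] principal_up_upper by (auto simp: up_sets_def)
  show "principal_up X x \<in> compact_saturated_sets X"
    using principal_up_self[OF x] principal_up_upper principal_up_compactin[OF x]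
    by (auto simp: compact_saturated_sets_def saturated_in_iff_upper_set_in)
qed (auto simp: up_sets_def compact_saturated_sets_def saturated_in_iff_upper_set_in)

end
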